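(* Let $t\ge 3$, let $j',j''$ be positive integers with $\max\{j',j''\}<t$ and $j'+j''>t$, and let $\ell^{\cap},\ell',\ell''\in\{1,\ldots,t\}$ be odd. Let $\mathcal{F}$ be the family of all ordered pairs $(A,B)$ of subsets of $E_t=\{1,\ldots,t\}$ such that $$|A|=j',\quad |B|=j'',\quad |A\cap B|>0,\quad \max\{j',j''\}<|A\cup B|=t,$$ $$\mathfrak{q}(A\cap B)=\ell^{\cap},\quad \mathfrak{q}(A-B)=\ell',\quad \mathfrak{q}(B-A)=\ell''.$$ Then: (i) The number of pairs $(A,B)\in\mathcal{F}$ with $\{1,t\}\cap A=\{1\}$ and $\{1,t\}\cap B=\{1,t\}$ is $$\mathfrak{T}\left(\theta,\beta;\tfrac{\ell^{\cap}+1}{2},\tfrac{\ell'-1}{2},\tfrac{\ell''+1}{2}\right)\cdot\mathtt{c}\bigl(\tfrac{\ell^{\cap}+1}{2};j'+j''-t\bigr)\cdot\mathtt{c}\bigl(\tfrac{\ell'-1}{2};t-j''\bigr)\cdot\mathtt{c}\bigl(\tfrac{\ell''+1}{2};t-j'\bigr).$$ (ii) The number of pairs $(A,B)\in\mathcal{F}$ with $\{1,t\}\cap A=\{1\}$ and $\{1,t\}\cap B=\{t\}$ is $$\mathfrak{T}\left(\alpha,\beta;\tfrac{\ell^{\cap}-1}{2},\tfrac{\ell'+1}{2},\tfrac{\ell''+1}{2}\right)\cdot\mathtt{c}\bigl(\tfrac{\ell^{\cap}-1}{2};j'+j''-t\bigr)\cdot\mathtt{c}\bigl(\tfrac{\ell'+1}{2};t-j''\bigr)\cdot\mathtt{c}\bigl(\tfrac{\ell''+1}{2};t-j'\bigr).$$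 (iii) The number of pairs $(A,B)\in\mathcal{F}$ with $\{1,t\}\cap A=\{1,t\}\cap B=\{1,t\}$ is $$\mathfrak{T}\left(\theta,\theta;\tfrac{\ell^{\cap}+1}{2},\tfrac{\ell'-1}{2},\tfrac{\ell''-1}{2}\right)\cdot\mathtt{c}\bigl(\tfrac{\ell^{\cap}+1}{2};j'+j''-t\bigr)\cdot\mathtt{c}\bigl(\tfrac{\ell'-1}{2};t-j''\bigr)\cdot\mathtt{c}\bigl(\tfrac{\ell''-1}{2};t-j'\bigr).$$ (iv) The number of pairs $(A,B)\in\mathcal{F}$ with $\{1,t\}\cap A=\{1,t\}$ and $|\{1,t\}\cap B|=0$ is $$\mathfrak{T}\left(\alpha,\alpha;\tfrac{\ell^{\cap}-1}{2},\tfrac{\ell'+1}{2},\tfrac{\ell''-1}{2}\right)\cdot\mathtt{c}\bigl(\tfrac{\ell^{\cap}-1}{2};j'+j''-t\bigr)\cdot\mathtt{c}\bigl(\tfrac{\ell'+1}{2};t-j''\bigr)\cdot\mathtt{c}\bigl(\tfrac{\ell''-1}{2};t-j'\bigr).$$ (v) The number of pairs $(A,B)\in\mathcal{F}$ with $\{1,t\}\cap A=\{1,t\}$ and $\{1,t\}\cap B=\{t\}$ is $$\mathfrak{T}\left(\alpha,\theta;\tfrac{\ell^{\cap}+1}{2},\tfrac{\ell'+1}{2},\tfrac{\ell''-1}{2}\right)\cdot\mathtt{c}\bigl(\tfrac{\ell^{\cap}+1}{2};j'+j''-t\bigr)\cdot\mathtt{c}\bigl(\tfrac{\ell'+1}{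2};t-j''\bigr)\cdot\mathtt{c}\bigl(\tfrac{\ell''-1}{2};t-j'\bigr).$$
   Context: The distinguished symmetric cycle $\boldsymbol{R}$ of the hypercube graph on $\{1,-1\}^t$ has vertices $R^0,\ldots,R^{2t-1}$, where $R^0=(1,\ldots,1)$; for $1\le s\le t-1$, $R^s\in\{1,-1\}^t$ has entries $-1$ exactly in positions $1,\ldots,s$; and $R^{k+t}=-R^k$ for $0\le k\le t-1$. The vectors $R^0,\ldots,R^{t-1}$ form a basis of $\mathbb{R}^t$, and for every $T\in\{1,-1\}^t$ there is a unique $\boldsymbol{x}=(x_1,\ldots,x_t)\in\{-1,0,1\}^t$ with $T=\sum_{i=1}^t x_iR^{i-1}$. Put $\boldsymbol{Q}(T,\boldsymbol{R})=\{x_iR^{i-1}\colon x_i\ne 0\}$; it is the unique inclusion-minimal subset of $\{R^0,\ldots,R^{2t-1}\}$ with sum $T$, and it has odd cardinality. For $A\subseteq E_t=\{1,\ldots,t\}$, ${}_{-A}\mathrm{T}^{(+)}$ is the vector in $\{1,-1\}^t$ whose set of coordinates equal to $-1$ is $A$, and $\mathfrak{q}(A)=|\boldsymbol{Q}({}_{-A}\mathrm{T}^{(+)},\boldsymbol{R})|$, i.e. the number of nonzero entries of the corresponding $\boldsymbol{x}$. $\mathtt{c}(m;n)=\binom{n-1}{m-1}$ is the number of compositions of the positive integer $n$ with $m$ positive parts (so $\mathtt{c}(0;n)=0$). A Smirnov word is a word in which any two adjacent letters differ. For $\mathfrak{s}',\mathfrak{s}''\in\{\theta,\alpha,\beta\}$,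 $\mathfrak{T}(\mathfrak{s}',\mathfrak{s}'';k,i,j)$ is the number of Smirnov words over the three-letter alphabet $(\theta,\alpha,\beta)$ that contain exactly $k$ letters $\theta$, $i$ letters $\alpha$ and $j$ letters $\beta$ (Parikh vector $(k,i,j)$), start with the letter $\mathfrak{s}'$ and end with the letter $\mathfrak{s}''$. *)

theory Defs
  imports Main
begin

text \<open>
  Vectors of \<open>t\<close>-space with integer entries are functions \<^typ>\<open>nat \<Rightarrow> int\<close> on the
  coordinates \<open>1, \<dots>, t\<close>, extended by \<open>0\<close> to all other indices.
\<close>

text \<open>
  The vertices of the distinguished symmetric cycle; only the indices \<open>k < 2 * t\<close> are meaningful.
  For \<open>k < t\<close> the entries \<open>-1\<close> of the \<open>k\<close>-th vertex are in the positions \<open>1, \<dots>, k\<close>, and the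
  vertex with index \<open>k + t\<close> is the negative of the \<open>k\<close>-th one.
\<close>

definition cyc_vertex :: "nat \<Rightarrow> nat \<Rightarrow> nat \<Rightarrow> int" where
  "cyc_vertex t k = (\<lambda>e. if e \<notin> {1..t} then 0
     else if k < t then (if e \<in> {1..k} then - 1 else 1)
     else - (if e \<in> {1..k - t} then - 1 else 1))"

definition is_cyc_coords :: "nat \<Rightarrow> (nat \<Rightarrow> int) \<Rightarrow> (nat \<Rightarrow> int) \<Rightarrow> bool" where
  "is_cyc_coords t T x \<longleftrightarrow>
     (\<forall>i\<in>{1..t}. x i \<in> {- 1, 0, 1}) \<and> (\<forall>i. i \<notin> {1..t} \<longrightarrow> x i = 0) \<and>
     T = (\<lambda>e. \<Sum>i = 1..t. x i * cyc_vertex t (i - 1) e)"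

definition cyc_coords :: "nat \<Rightarrow> (nat \<Rightarrow> int) \<Rightarrow> nat \<Rightarrow> int" where
  "cyc_coords t T = (THE x. is_cyc_coords t T x)"

text \<open>
  The set \<open>Q(T, R)\<close> of the summands occurring in \<open>T\<close>; \<open>decomp_size\<close> below is the statistic
  \<open>q(A) = |Q(T, R)|\<close> for the sign vector \<open>T\<close> with negative part \<open>A\<close>.
\<close>

definition cyc_decomp :: "nat \<Rightarrow> (nat \<Rightarrow> int) \<Rightarrow> (nat \<Rightarrow> int) set" where
  "cyc_decomp t T =
     {(\<lambda>e. cyc_coords t T i * cyc_vertex t (i - 1) e) | i. i \<in> {1..t} \<and> cyc_coords t T i \<noteq> 0}"

definition sign_vec :: "nat \<Rightarrow> nat set \<Rightarrow> nat \<Rightarrow> int" where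
  "sign_vec t A = (\<lambda>e. if e \<notin> {1..t} then 0 else if e \<in> A then - 1 else 1)"

definition decomp_size :: "nat \<Rightarrow> nat set \<Rightarrow> nat" where
  "decomp_size t A = card (cyc_decomp t (sign_vec t A))"

text \<open>
  The number \<open>binomial (n - 1) (m - 1)\<close> of compositions of a positive integer \<open>n\<close> with \<open>m\<close>
  positive parts.  For \<open>m = 0\<close> the lower entry is \<open>-1\<close>, which truncated subtraction would
  turn into \<open>0\<close>.
\<close>

definition num_compositions :: "nat \<Rightarrow> nat \<Rightarrow> nat" where
  "num_compositions m n = (if m = 0 then 0 else (n - 1) choose (m - 1))"

datatype letter = Theta | Alpha | Beta

text \<open>A Smirnov word is a list satisfying \<^const>\<open>distinct_adj\<close>.\<close>

definition smirnov_count :: "letter \<Rightarrow> letter \<Rightarrow> nat \<Rightarrow> nat \<Rightarrow> nat \<Rightarrow> nat" where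
  "smirnov_count s' s'' k i j =
     card {w. distinct_adj w \<and> w \<noteq> [] \<and> hd w = s' \<and> last w = s'' \<and>
              count_list w Theta = k \<and> count_list w Alpha = i \<and> count_list w Beta = j}"

definition pair_family ::
    "nat \<Rightarrow> nat \<Rightarrow> nat \<Rightarrow> nat \<Rightarrow> nat \<Rightarrow> nat \<Rightarrow> (nat set \<times> nat set) set" where
  "pair_family t j' j'' lcap l' l'' =
     {(A, B). A \<subseteq> {1..t} \<and> B \<subseteq> {1..t} \<and> card A = j' \<and> card B = j'' \<and>
              card (A \<inter> B) > 0 \<and> max j' j'' < card (A \<union> B) \<and> card (A \<union> B) = t \<and>
              decomp_size t (A \<inter> B) = lcap \<and> decomp_size t (A - B) = l' \<and>
              decomp_size t (B - A) = l''}"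

end

theory Submission
  imports Defs
begin

text \<open>
  The coordinates of a sign vector in the basis \<open>R\<^sup>0, \<dots>, R\<^sup>t\<^sup>-\<^sup>1\<close> are half the
  differences of consecutive entries, together with half the sum of the first and the last entry.
  Hence \<open>q(A)\<close> counts the places where membership in \<open>A\<close> changes along \<open>1, \<dots>, t\<close>, plus
  one if the two ends agree.  As every maximal interval (run) of \<open>A\<close> is bounded by two changes,
  except at the ends, \<open>q(A) = 2 r - 1\<close> if \<open>A\<close> contains an end and \<open>q(A) = 2 r + 1\<close>
  otherwise, where \<open>r\<close> is the number of runs (\<open>decomp_size_runs\<close>).

  A pair \<open>(A, B)\<close> with \<open>A \<union> B = {1, \<dots>, t}\<close> is the same thing as a word of length \<open>t\<close>
  over three letters, which record whether a position belongs to both sets or to just one of them.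
  The cardinalities become letter multiplicities, the values of \<open>q\<close> become numbers of runs of
  the letters, and the conditions on \<open>{1, t}\<close> fix the first and the last letter.  Contracting
  each run to one letter, which is what \<^const>\<open>remdups_adj\<close> does, gives a Smirnov word; to go back
  one chooses, independently for each letter, a composition of its multiplicity into as
  many parts as it has runs (\<open>card_words_with_runs\<close>).  All five formulas are instances of the
  resulting count for prescribed first and last letter (\<open>card_pairs_with_end_letters\<close>).
\<close>

section \<open>Decomposition size as a number of changes\<close>

lemma cyc_vertex_eq:
  assumes "i \<in> {1..t}" "e \<in> {1..t}"
  shows "cyc_vertex t (i - 1) e = (if i \<le> e then 1 else - 1)"
  using assms by (auto simp: cyc_vertex_def)

lemma sum_cyc_vertex:
  assumes "e \<in> {1..t}"
  shows "(\<Sum>i = 1..t. x i * cyc_vertex t (i - 1) e) = 2 * (\<Sum>i = 1..e. x i) - (\<Sum>i = 1..t. x i)"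
proof -
  have split: "{1..t} = {1..e} \<union> {e<..t}" "{1..e} \<inter> {e<..t} = {}"
    using assms by auto
  have "(\<Sum>i = 1..t. x i * cyc_vertex t (i - 1) e) = (\<Sum>i = 1..t. x i * (if i \<le> e then 1 else - 1))"
    using assms by (intro sum.cong) (auto simp: cyc_vertex_eq simp del: One_nat_def)
  also have "\<dots> = (\<Sum>i = 1..e. x i) - (\<Sum>i \<in> {e<..t}. x i)"
    by (simp add: split sum.union_disjoint sum_negf del: One_nat_def)
  also have "\<dots> = 2 * (\<Sum>i = 1..e. x i) - (\<Sum>i = 1..t. x i)"
    by (simp add: split sum.union_disjoint del: One_nat_def)
  finally show ?thesis .
qed

text \<open>
  For an entry \<open>1 - 2 [e \<in> A]\<close> of the sign vector these are half the sum of the first and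
  the last entry and half the differences of consecutive entries.
\<close>

definition sign_coords :: "nat \<Rightarrow> nat set \<Rightarrow> nat \<Rightarrow> int" where
  "sign_coords t A e =
     (if e = 1 then 1 - of_bool (1 \<in> A) - of_bool (t \<in> A)
      else if e \<in> {2..t} then of_bool (e - 1 \<in> A) - of_bool (e \<in> A) else 0)"

text \<open>
  The sum telescopes.  For the entry at \<open>e\<close> of the combination of the \<open>R\<^sup>i\<^sup>-\<^sup>1\<close>, the
  coordinates enter only through this partial sum and the full one (\<open>sum_cyc_vertex\<close>).
\<close>

lemma sum_sign_coords:
  assumes "1 \<le> e" "e \<le> t"
  shows "(\<Sum>i = 1..e. sign_coords t A i) = 1 - of_bool (t \<in> A) - of_bool (e \<in> A)"
  using assms
proof (induction e rule: nat_induct_at_least)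
  case base
  then show ?case by (simp add: sign_coords_def)
next
  case (Suc e)
  then show ?case by (simp add: sign_coords_def)
qed

lemma is_cyc_coords_sign_coords:
  assumes "t \<ge> 1"
  shows "is_cyc_coords t (sign_vec t A) (sign_coords t A)"
proof -
  have "sign_vec t A e = (\<Sum>i = 1..t. sign_coords t A i * cyc_vertex t (i - 1) e)" for e
  proof (cases "e \<in> {1..t}")
    case True
    then have "(\<Sum>i = 1..e. sign_coords t A i) = 1 - of_bool (t \<in> A) - of_bool (e \<in> A)"
      "(\<Sum>i = 1..t. sign_coords t A i) = 1 - of_bool (t \<in> A) - of_bool (t \<in> A)"
      using assms by (intro sum_sign_coords; simp)+
    then show ?thesis
      using True by (simp add: sum_cyc_vertex sign_vec_def del: One_nat_def)
  next
    case False
    then show ?thesis by (simp add: sign_vec_def cyc_vertex_def)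
  qed
  then have "sign_vec t A = (\<lambda>e. \<Sum>i = 1..t. sign_coords t A i * cyc_vertex t (i - 1) e)"
    by (rule ext)
  then show ?thesis
    using assms unfolding is_cyc_coords_def by (auto simp: sign_coords_def)
qed

lemma is_cyc_coords_unique:
  assumes "is_cyc_coords t T x" "is_cyc_coords t T y"
  shows "x = y"
proof
  fix i
  have T: "T e = 2 * (\<Sum>i = 1..e. z i) - (\<Sum>i = 1..t. z i)"
    if "is_cyc_coords t T z" "e \<in> {1..t}" for z e
    using that sum_cyc_vertex[OF that(2), of z] by (simp add: is_cyc_coords_def)
  have first: "T 1 + T t = 2 * z 1" if "is_cyc_coords t T z" "1 \<le> t" for z
    using T[OF that(1), of 1] T[OF that(1), of t] that(2) by simp
  have later: "T (Suc e) - T e = 2 * z (Suc e)" if "is_cyc_coords t T z" "1 \<le> e" "e < t" for z e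
    using T[OF that(1), of e] T[OF that(1), of "Suc e"] that(2,3) by simp
  consider "i \<notin> {1..t}" | "i = 1" "1 \<le> t" | e where "i = Suc e" "1 \<le> e" "e < t"
    by (cases i) force+
  then show "x i = y i"
  proof cases
    case 1
    then show ?thesis using assms by (simp add: is_cyc_coords_def)
  next
    case 2
    then show ?thesis using first[of x] first[of y] assms by simp
  next
    case 3
    then show ?thesis using later[of x e] later[of y e] assms by simp
  qed
qed

lemma cyc_coords_sign_vec: "t \<ge> 1 \<Longrightarrow> cyc_coords t (sign_vec t A) = sign_coords t A"
  unfolding cyc_coords_def
  by (intro the_equality is_cyc_coords_unique[OF _ is_cyc_coords_sign_coords] is_cyc_coords_sign_coords)

text \<open>
  Distinct indices contribute distinct vectors: all \<open>R\<^sup>0, \<dots>, R\<^sup>t\<^sup>-\<^sup>1\<close> have last entry \<open>1\<close>, so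
  equal summands have equal coefficients, and for \<open>i < k\<close> the vertices
  \<open>R\<^sup>i\<^sup>-\<^sup>1\<close> and \<open>R\<^sup>k\<^sup>-\<^sup>1\<close> differ in the coordinate \<open>i\<close>.
\<close>

lemma decomp_size_eq_card_support:
  assumes "t \<ge> 1"
  shows "decomp_size t A = card {i \<in> {1..t}. sign_coords t A i \<noteq> 0}"
proof -
  let ?I = "{i \<in> {1..t}. sign_coords t A i \<noteq> 0}"
  let ?f = "\<lambda>i e. sign_coords t A i * cyc_vertex t (i - 1) e"
  have "inj_on ?f ?I"
  proof (rule linorder_inj_onI)
    fix i k assume ik: "i < k" "i \<in> ?I" "k \<in> ?I"
    show "?f i \<noteq> ?f k"
    proof
      assume eq: "?f i = ?f k"
      have "?f i t = ?f k t" "?f i i = ?f k i"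
        using fun_cong[OF eq] by auto
      then show False
        using ik by (simp add: cyc_vertex_eq del: One_nat_def)
    qed
  qed auto
  moreover have "cyc_decomp t (sign_vec t A) = ?f ` ?I"
    unfolding cyc_decomp_def cyc_coords_sign_vec[OF assms] by auto
  ultimately show ?thesis
    by (simp add: decomp_size_def card_image)
qed

lemma decomp_size_changes:
  assumes "t \<ge> 1"
  shows "decomp_size t A =
    of_bool (1 \<in> A \<longleftrightarrow> t \<in> A) + card {e \<in> {2..t}. (e \<in> A) \<noteq> (e - 1 \<in> A)}"
proof -
  let ?C = "{e \<in> {2..t}. (e \<in> A) \<noteq> (e - 1 \<in> A)}"
  have "{i \<in> {1..t}. sign_coords t A i \<noteq> 0} = (if 1 \<in> A \<longleftrightarrow> t \<in> A then {1} else {}) \<union> ?C"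
    using assms by (auto simp: sign_coords_def split: if_splits)
  moreover have "card ((if 1 \<in> A \<longleftrightarrow> t \<in> A then {1} else {}) \<union> ?C)
      = of_bool (1 \<in> A \<longleftrightarrow> t \<in> A) + card ?C"
    by (subst card_Un_disjoint) auto
  ultimately show ?thesis
    using assms by (simp add: decomp_size_eq_card_support)
qed

section \<open>Runs of a letter\<close>

lemma count_list_map_upt:
  "count_list (map f [1..<Suc t]) s = card {e \<in> {1..t}. f e = s}"
proof (induction t)
  case 0
  then show ?case by simp
next
  case (Suc t)
  have "{e \<in> {1..Suc t}. f e = s} = {e \<in> {1..t}. f e = s} \<union> (if f (Suc t) = s then {Suc t} else {})"
    by (auto simp: le_Suc_eq)
  moreover have "card ({e \<in> {1..t}. f e = s} \<union> (if f (Suc t) = s then {Suc t} else {}))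
      = card {e \<in> {1..t}. f e = s} + of_bool (f (Suc t) = s)"
    by (subst card_Un_disjoint) auto
  ultimately show ?case using Suc by simp
qed

text \<open>
  The runs of \<open>s\<close> in a word are the occurrences of \<open>s\<close> in its contraction.  Each run has two
  borders, and each border is a change from or to \<open>s\<close> or an end of the word.
\<close>

lemma twice_runs_eq_changes:
  assumes "t \<ge> 1"
  shows "2 * count_list (remdups_adj (map f [1..<Suc t])) s =
    card {e \<in> {2..t}. (f e = s) \<noteq> (f (e - 1) = s)} + of_bool (f 1 = s) + of_bool (f t = s)"
  using assms
proof (induction t rule: nat_induct_at_least)
  case base
  have "{e \<in> {2..1::nat}. (f e = s) \<noteq> (f (e - 1) = s)} = {}" by auto
  then show ?case by simp
next
  case (Suc t)
  let ?C = "\<lambda>t. {e \<in> {2..t}. (f e = s) \<noteq> (f (e - 1) = s)}"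
  let ?N = "if (f (Suc t) = s) \<noteq> (f t = s) then {Suc t} else {}"
  have "?C (Suc t) = ?C t \<union> ?N"
    using \<open>1 \<le> t\<close> by (auto simp: le_Suc_eq)
  moreover have "card (?C t \<union> ?N) = card (?C t) + of_bool ((f (Suc t) = s) \<noteq> (f t = s))"
    by (subst card_Un_disjoint) auto
  moreover have word: "map f [1..<Suc t] = map f [1..<t] @ [f t]"
    "map f [1..<Suc (Suc t)] = map f [1..<t] @ [f t, f (Suc t)]"
    using \<open>1 \<le> t\<close> by simp_all
  moreover have "remdups_adj (map f [1..<Suc (Suc t)]) =
      remdups_adj (map f [1..<Suc t]) @ (if f t = f (Suc t) then [] else [f (Suc t)])"
    unfolding word by (rule remdups_adj_append_two)
  ultimately show ?case
    using Suc.IH by (auto simp del: upt_Suc)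
qed

lemma decomp_size_runs:
  assumes "t \<ge> 1"
    and A: "\<And>e. e \<in> {1..t} \<Longrightarrow> e \<in> A \<longleftrightarrow> f e = s"
  shows "decomp_size t A + of_bool (f 1 = s \<or> f t = s) =
    2 * count_list (remdups_adj (map f [1..<Suc t])) s + of_bool (f 1 \<noteq> s \<and> f t \<noteq> s)"
proof -
  have "{e \<in> {2..t}. (e \<in> A) \<noteq> (e - 1 \<in> A)} = {e \<in> {2..t}. (f e = s) \<noteq> (f (e - 1) = s)}"
  proof (rule Collect_cong, rule conj_cong[OF refl])
    fix e assume "e \<in> {2..t}"
    then have "e \<in> {1..t}" "e - 1 \<in> {1..t}" by auto
    then show "((e \<in> A) \<noteq> (e - 1 \<in> A)) \<longleftrightarrow> ((f e = s) \<noteq> (f (e - 1) = s))"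
      using A by simp
  qed
  moreover have "1 \<in> A \<longleftrightarrow> f 1 = s" "t \<in> A \<longleftrightarrow> f t = s"
    using A assms(1) by auto
  ultimately show ?thesis
    unfolding twice_runs_eq_changes[OF assms(1)] decomp_size_changes[OF assms(1)] by auto
qed

text \<open>
  The number of runs of a set that an odd value \<open>l\<close> of \<open>q\<close> forces; \<open>ends\<close> tells whether the
  set contains \<open>1\<close> or \<open>t\<close>.
\<close>

definition runs_of_size :: "bool \<Rightarrow> nat \<Rightarrow> nat" where
  "runs_of_size ends l = (if ends then (l + 1) div 2 else (l - 1) div 2)"

lemma decomp_size_eq_iff_runs:
  assumes "t \<ge> 1" "odd l" "\<And>e. e \<in> {1..t} \<Longrightarrow> e \<in> A \<longleftrightarrow> f e = s"
  shows "decomp_size t A = l \<longleftrightarrow>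
    count_list (remdups_adj (map f [1..<Suc t])) s = runs_of_size (f 1 = s \<or> f t = s) l"
proof -
  obtain k where "l = 2 * k + 1" using assms(2) by (rule oddE)
  then show ?thesis
    using decomp_size_runs[OF assms(1,3)] by (auto simp: runs_of_size_def simp del: upt_Suc)
qed

section \<open>Words with a given contraction\<close>

text \<open>
  Unlike \<^const>\<open>num_compositions\<close>, this counts the empty composition of \<open>0\<close>, so that
  Pascal's recursion holds without exceptions.
\<close>

fun compositions :: "nat \<Rightarrow> nat \<Rightarrow> nat" where
  "compositions 0 n = of_bool (n = 0)"
| "compositions (Suc m) 0 = 0"
| "compositions (Suc m) (Suc n) = compositions (Suc m) n + compositions m n"

lemma compositions_Suc_Suc: "compositions (Suc m) (Suc n) = n choose m"
proof (induction n arbitrary: m)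
  case 0
  then show ?case by (cases m) auto
next
  case (Suc n)
  have "compositions (Suc m) (Suc (Suc n)) = compositions (Suc m) (Suc n) + compositions m (Suc n)"
    by (rule compositions.simps(3))
  then show ?case
    using Suc by (cases m) (simp_all del: compositions.simps(3))
qed

lemma compositions_eq_num_compositions: "n > 0 \<Longrightarrow> compositions m n = num_compositions m n"
  by (cases m; cases n) (simp_all add: compositions_Suc_Suc num_compositions_def del: compositions.simps(3))

lemma finite_words_with_counts:
  assumes "finite S"
  shows "finite {w. set w \<subseteq> S \<and> (\<forall>s\<in>S. count_list w s = n s)}"
proof (rule finite_subset)
  have "length w = sum n S" if "set w \<subseteq> S" "\<forall>s\<in>S. count_list w s = n s" for w
    using sum_count_set[OF that(1) assms] that(2) by simp
  then show "{w. set w \<subseteq> S \<and> (\<forall>s\<in>S. count_list w s = n s)} \<subseteq> {w. set w \<subseteq> S \<and> length w = sum n S}"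
    by auto
  show "finite {w. set w \<subseteq> S \<and> length w = sum n S}"
    using assms by (rule finite_lists_length_eq)
qed

lemma remdups_adj_Cons_eq_iff:
  assumes "distinct_adj (a # v)"
  shows "remdups_adj (a # w) = a # v \<longleftrightarrow> remdups_adj w = a # v \<or> remdups_adj w = v"
  using assms by (auto simp: remdups_adj_Cons split: list.splits)

text \<open>
  Removing the first letter \<open>a\<close> from a word with contraction \<open>a # v\<close> either shortens the first
  run, and the contraction stays the same, or removes it, and the contraction becomes
  \<open>v\<close>.  These two cases are the two summands of Pascal's recursion for the letter \<open>a\<close>.
\<close>

lemma card_words_with_contraction:
  assumes "finite S" "distinct_adj v" "set v \<subseteq> S"
  shows "card {w. remdups_adj w = v \<and> (\<forall>s\<in>S. count_list w s = n s)} =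
    (\<Prod>s\<in>S. compositions (count_list v s) (n s))"
  using assms(2,3)
proof (induction "sum n S" arbitrary: n v rule: less_induct)
  case less
  let ?F = "\<lambda>v n. {w. remdups_adj w = v \<and> (\<forall>s\<in>S. count_list w s = n s)}"
  have finite_fibre: "finite (?F v n)" if "set v \<subseteq> S" for v n
  proof (rule finite_subset)
    show "?F v n \<subseteq> {w. set w \<subseteq> S \<and> (\<forall>s\<in>S. count_list w s = n s)}"
      using that by auto
    show "finite {w. set w \<subseteq> S \<and> (\<forall>s\<in>S. count_list w s = n s)}"
      using \<open>finite S\<close> by (rule finite_words_with_counts)
  qed
  show ?case
  proof (cases v)
    case Nil
    have "?F [] n = (if \<forall>s\<in>S. n s = 0 then {[]} else {})"
      by (auto simp: eq_commute[of 0])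
    then show ?thesis
      using \<open>finite S\<close> Nil by auto
  next
    case (Cons a u)
    have a: "a \<in> S" "set u \<subseteq> S" "distinct_adj u"
      using less.prems Cons by (auto dest: distinct_adj_ConsD)
    show ?thesis
    proof (cases "n a")
      case 0
      have "count_list w a \<noteq> n a" if "remdups_adj w = a # u" for w
        using that 0 by (metis count_list_0_iff list.set_intros(1) remdups_adj_set)
      then have "?F v n = {}"
        using a(1) Cons by blast
      moreover have "(\<Prod>s\<in>S. compositions (count_list v s) (n s)) = 0"
        using \<open>finite S\<close> a(1) 0 Cons by (intro prod_zero bexI[of _ a]) auto
      ultimately show ?thesis by (simp only: card.empty)
    next
      case (Suc k)
      let ?n = "n(a := k)"
      have "sum ?n S < sum n S"
        using \<open>finite S\<close> a(1) Suc by (intro sum_strict_mono_ex1) auto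
      note IH = less.hyps[OF this]
      have "?F v n = Cons a ` (?F v ?n \<union> ?F u ?n)"
      proof (intro equalityI subsetI)
        fix w assume w: "w \<in> ?F v n"
        then obtain b w' where w': "w = b # w'"
          using Cons by (cases w) auto
        have "b = a"
          using w w' Cons hd_remdups_adj[of w] by simp
        moreover have "remdups_adj w' = v \<or> remdups_adj w' = u"
          using w w' \<open>b = a\<close> Cons less.prems(1) remdups_adj_Cons_eq_iff[of a u w'] by simp
        moreover have "\<forall>s\<in>S. count_list w' s = ?n s"
          using w w' \<open>b = a\<close> Suc by auto
        ultimately show "w \<in> Cons a ` (?F v ?n \<union> ?F u ?n)"
          using w' by auto
      next
        fix w assume "w \<in> Cons a ` (?F v ?n \<union> ?F u ?n)"
        then obtain w' where "w = a # w'" "remdups_adj w' = v \<or> remdups_adj w' = u"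
          "\<forall>s\<in>S. count_list w' s = ?n s"
          by auto
        then show "w \<in> ?F v n"
          using Cons less.prems(1) remdups_adj_Cons_eq_iff[of a u w'] Suc by auto
      qed
      then have "card (?F v n) = card (?F v ?n \<union> ?F u ?n)"
        by (simp add: card_image)
      also have "\<dots> = card (?F v ?n) + card (?F u ?n)"
        using finite_fibre less.prems(2) a(2) Cons by (intro card_Un_disjoint) auto
      also have "\<dots> = (\<Prod>s\<in>S. compositions (count_list v s) (?n s))
          + (\<Prod>s\<in>S. compositions (count_list u s) (?n s))"
        using IH less.prems a by simp
      also have "\<dots> = (\<Prod>s\<in>S. compositions (count_list v s) (n s))"
      proof -
        let ?P = "\<Prod>s\<in>S - {a}. compositions (count_list v s) (n s)"
        have "(\<Prod>s\<in>S - {a}. compositions (count_list v s) (?n s)) = ?P"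
          "(\<Prod>s\<in>S - {a}. compositions (count_list u s) (?n s)) = ?P"
          unfolding Cons by (rule prod.cong; auto)+
        then show ?thesis
          using Suc Cons by (simp add: prod.remove[OF \<open>finite S\<close> a(1)] algebra_simps)
      qed
      finally show ?thesis .
    qed
  qed
qed

lemma UNIV_letter: "(UNIV :: letter set) = {Theta, Alpha, Beta}"
  using letter.exhaust by auto

lemma finite_UNIV_letter: "finite (UNIV :: letter set)"
  by (simp add: UNIV_letter)

lemma all_letter_iff: "(\<forall>s. P s) \<longleftrightarrow> P Theta \<and> P Alpha \<and> P Beta"
  by (metis letter.exhaust)

text \<open>
  Group the words by their contraction: it ranges over the Smirnov words with letter counts \<open>r\<close>,
  and the number of words over each of them depends on \<open>r\<close> and \<open>n\<close> only.
\<close>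

lemma card_words_with_runs:
  "card {w. w \<noteq> [] \<and> hd w = s' \<and> last w = s'' \<and>
      (\<forall>s. count_list w s = n s) \<and> (\<forall>s. count_list (remdups_adj w) s = r s)} =
    smirnov_count s' s'' (r Theta) (r Alpha) (r Beta) * (\<Prod>s\<in>UNIV. compositions (r s) (n s))"
    (is "card ?W = _")
proof -
  let ?V = "{v. distinct_adj v \<and> v \<noteq> [] \<and> hd v = s' \<and> last v = s'' \<and> (\<forall>s. count_list v s = r s)}"
  let ?F = "\<lambda>v. {w. remdups_adj w = v \<and> (\<forall>s. count_list w s = n s)}"
  have finite_counts: "finite {w. \<forall>s :: letter. count_list w s = m s}" for m
    using finite_words_with_counts[OF finite_UNIV_letter, of m] by simp
  have "?W = (\<Union>v\<in>?V. ?F v)"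
    by (auto simp: last_remdups_adj)
  moreover have "card (\<Union>v\<in>?V. ?F v) = (\<Sum>v\<in>?V. card (?F v))"
  proof (rule card_UN_disjoint)
    show "finite ?V"
      by (rule finite_subset[OF _ finite_counts[of r]]) auto
    show "\<forall>v\<in>?V. finite (?F v)"
      by (auto intro: finite_subset[OF _ finite_counts[of n]])
  qed auto
  moreover have "(\<Sum>v\<in>?V. card (?F v)) = (\<Sum>v\<in>?V. \<Prod>s\<in>UNIV. compositions (r s) (n s))"
    using card_words_with_contraction[OF finite_UNIV_letter, of _ n] by (intro sum.cong) auto
  moreover have "card ?V = smirnov_count s' s'' (r Theta) (r Alpha) (r Beta)"
    by (simp add: smirnov_count_def all_letter_iff)
  ultimately show ?thesis
    by simp
qed

section \<open>Pairs of sets as words\<close>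

text \<open>
  \<open>Beta\<close> stands for positions in \<open>B - A\<close>; its value outside \<open>A \<union> B\<close> is a default that
  is never met, because \<open>A \<union> B\<close> will contain all positions.
\<close>

definition letter_at :: "nat set \<Rightarrow> nat set \<Rightarrow> nat \<Rightarrow> letter" where
  "letter_at A B e = (if e \<in> A then if e \<in> B then Theta else Alpha else Beta)"

lemma letter_at_eq_iff:
  "letter_at A B e = Theta \<longleftrightarrow> e \<in> A \<and> e \<in> B"
  "letter_at A B e = Alpha \<longleftrightarrow> e \<in> A \<and> e \<notin> B"
  "letter_at A B e = Beta \<longleftrightarrow> e \<notin> A"
  by (auto simp: letter_at_def)

definition pair_word :: "nat \<Rightarrow> nat set \<times> nat set \<Rightarrow> letter list" where
  "pair_word t = (\<lambda>(A, B). map (letter_at A B) [1..<Suc t])"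

lemma bij_betw_restrict_iff:
  assumes "bij_betw f A B" "A' \<subseteq> A" "B' \<subseteq> B" "\<And>x. x \<in> A \<Longrightarrow> x \<in> A' \<longleftrightarrow> f x \<in> B'"
  shows "bij_betw f A' B'"
proof -
  have "f ` A' = B'"
    using assms(2,3,4) bij_betw_imp_surj_on[OF assms(1)] by blast
  then show ?thesis
    using bij_betw_subset[OF assms(1,2)] by simp
qed

lemma bij_betw_pair_word:
  "bij_betw (pair_word t) {(A, B). A \<union> B = {1..t}} {w. length w = t}"
proof (rule bij_betw_byWitness)
  let ?g = "\<lambda>w. ({e \<in> {1..t}. w ! (e - 1) \<in> {Theta, Alpha}}, {e \<in> {1..t}. w ! (e - 1) \<in> {Theta, Beta}})"
  show "\<forall>p \<in> {(A, B). A \<union> B = {1..t}}. ?g (pair_word t p) = p"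
  proof
    fix p :: "nat set \<times> nat set" assume "p \<in> {(A, B). A \<union> B = {1..t}}"
    then obtain A B where p: "p = (A, B)" and AB: "A \<union> B = {1..t}"
      by blast
    have nth: "pair_word t (A, B) ! (e - 1) = letter_at A B e" if "e \<in> {1..t}" for e
      using that by (auto simp: pair_word_def simp del: upt_Suc)
    have "A \<subseteq> {1..t}" "B \<subseteq> {1..t}" "{1..t} - A \<subseteq> B"
      using AB by blast+
    then have "{e \<in> {1..t}. letter_at A B e \<in> {Theta, Alpha}} = A"
      "{e \<in> {1..t}. letter_at A B e \<in> {Theta, Beta}} = B"
      unfolding letter_at_def by (auto split: if_splits)
    then show "?g (pair_word t p) = p"
      unfolding p by (simp add: nth cong: conj_cong del: One_nat_def)
  qed
  show "\<forall>w \<in> {w. length w = t}. pair_word t (?g w) = w"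
  proof
    fix w :: "letter list" assume "w \<in> {w. length w = t}"
    then show "pair_word t (?g w) = w"
      by (intro nth_equalityI)
        (auto simp: pair_word_def letter_at_def simp del: upt_Suc, metis letter.exhaust)
  qed
  show "pair_word t ` {(A, B). A \<union> B = {1..t}} \<subseteq> {w. length w = t}"
    by (auto simp: pair_word_def)
  have "x \<in> {Theta, Alpha} \<or> x \<in> {Theta, Beta}" for x
    by (cases x) auto
  then have "fst (?g w) \<union> snd (?g w) = {1..t}" for w
    unfolding fst_conv snd_conv by blast
  then show "?g ` {w. length w = t} \<subseteq> {(A, B). A \<union> B = {1..t}}"
    by (simp add: image_subset_iff)
qed

lemma pair_family_Un:
  assumes "(A, B) \<in> pair_family t j' j'' lcap l' l''"
  shows "A \<union> B = {1..t}"
  using assms by (intro card_subset_eq) (auto simp: pair_family_def)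

text \<open>
  As \<open>A \<union> B\<close> is everything, \<open>|A| = j'\<close> and \<open>|B| = j''\<close> say that \<open>j' + j'' - t\<close>
  positions carry \<open>Theta\<close>, \<open>t - j''\<close> carry \<open>Alpha\<close> and \<open>t - j'\<close> carry \<open>Beta\<close>.
\<close>

lemma card_pairs_with_end_letters:
  fixes s' s'' :: letter
  assumes "t \<ge> 1" "max j' j'' < t" "j' + j'' > t" "odd lcap" "odd l'" "odd l''"
  defines "r \<equiv> \<lambda>s. runs_of_size (s' = s \<or> s'' = s)"
  shows "card {(A, B) \<in> pair_family t j' j'' lcap l' l''. letter_at A B 1 = s' \<and> letter_at A B t = s''} =
    smirnov_count s' s'' (r Theta lcap) (r Alpha l') (r Beta l'')
    * num_compositions (r Theta lcap) (j' + j'' - t)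
    * num_compositions (r Alpha l') (t - j'')
    * num_compositions (r Beta l'') (t - j')"
proof -
  define n where "n = case_letter (j' + j'' - t) (t - j'') (t - j')"
  define R where "R = case_letter (r Theta lcap) (r Alpha l') (r Beta l'')"
  let ?P = "{(A, B) \<in> pair_family t j' j'' lcap l' l''. letter_at A B 1 = s' \<and> letter_at A B t = s''}"
  let ?W = "{w. w \<noteq> [] \<and> hd w = s' \<and> last w = s'' \<and>
      (\<forall>s. count_list w s = n s) \<and> (\<forall>s. count_list (remdups_adj w) s = R s)}"
  have "(A, B) \<in> ?P \<longleftrightarrow> pair_word t (A, B) \<in> ?W" if AB: "A \<union> B = {1..t}" for A B
  proof -
    let ?w = "map (letter_at A B) [1..<Suc t]"
    have fin: "finite A" "finite B"
      using AB by (metis finite_Un finite_atLeastAtMost)+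
    have theta: "e \<in> A \<inter> B \<longleftrightarrow> letter_at A B e = Theta"
      and alpha: "e \<in> A - B \<longleftrightarrow> letter_at A B e = Alpha"
      and beta: "e \<in> B - A \<longleftrightarrow> letter_at A B e = Beta" if "e \<in> {1..t}" for e
    proof -
      have "e \<in> A \<or> e \<in> B"
        using AB that by blast
      then show "e \<in> A \<inter> B \<longleftrightarrow> letter_at A B e = Theta" "e \<in> A - B \<longleftrightarrow> letter_at A B e = Alpha"
        "e \<in> B - A \<longleftrightarrow> letter_at A B e = Beta"
        by (auto simp: letter_at_eq_iff)
    qed
    have "{e \<in> {1..t}. letter_at A B e = Theta} = A \<inter> B"
      "{e \<in> {1..t}. letter_at A B e = Alpha} = A - B"
      "{e \<in> {1..t}. letter_at A B e = Beta} = B - A"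
      using AB theta alpha beta by blast+
    then have counts: "count_list ?w Theta = card (A \<inter> B)" "count_list ?w Alpha = card (A - B)"
      "count_list ?w Beta = card (B - A)"
      by (simp_all only: count_list_map_upt)
    have cards: "card A = card (A \<inter> B) + card (A - B)" "card B = card (A \<inter> B) + card (B - A)"
      "t = card (A \<inter> B) + card (A - B) + card (B - A)"
    proof -
      show *: "card A = card (A \<inter> B) + card (A - B)"
        using fin card_Int_Diff by metis
      show "card B = card (A \<inter> B) + card (B - A)"
        using fin card_Int_Diff[of B A] by (simp add: Int_commute)
      have "card (A \<union> B) = card A + card (B - A)"
        using fin card_Un_disjoint[of A "B - A"] by simp
      then show "t = card (A \<inter> B) + card (A - B) + card (B - A)"
        using AB * by simp
    qed
    have hd_last: "?w \<noteq> []" "hd ?w = letter_at A B 1" "last ?w = letter_at A B t"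
      using assms(1) by (simp_all add: hd_map hd_append)
    have counts_iff: "card A = j' \<and> card B = j'' \<longleftrightarrow> (\<forall>s. count_list ?w s = n s)"
      unfolding all_letter_iff counts n_def letter.case
      using cards assms(2,3) by linarith
    have runs_iff: "decomp_size t (A \<inter> B) = lcap \<and> decomp_size t (A - B) = l' \<and> decomp_size t (B - A) = l''
        \<longleftrightarrow> (\<forall>s. count_list (remdups_adj ?w) s = R s)"
      if "letter_at A B 1 = s'" "letter_at A B t = s''"
      unfolding all_letter_iff R_def letter.case r_def that[symmetric]
      using decomp_size_eq_iff_runs[OF assms(1,4) theta] decomp_size_eq_iff_runs[OF assms(1,5) alpha]
        decomp_size_eq_iff_runs[OF assms(1,6) beta] by simp
    have "card (A \<inter> B) > 0" if "card A = j'" "card B = j''"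
      using cards that assms(2,3) by linarith
    moreover have "A \<subseteq> {1..t}" "B \<subseteq> {1..t}"
      using AB by blast+
    moreover have "card (A \<union> B) = t"
      using AB by simp
    ultimately have "(A, B) \<in> pair_family t j' j'' lcap l' l'' \<longleftrightarrow> (card A = j' \<and> card B = j'') \<and>
        decomp_size t (A \<inter> B) = lcap \<and> decomp_size t (A - B) = l' \<and> decomp_size t (B - A) = l''"
      using assms(2) unfolding pair_family_def mem_Collect_eq case_prod_conv by blast
    moreover have "pair_word t (A, B) \<in> ?W \<longleftrightarrow> letter_at A B 1 = s' \<and> letter_at A B t = s'' \<and>
        (\<forall>s. count_list ?w s = n s) \<and> (\<forall>s. count_list (remdups_adj ?w) s = R s)"
      using hd_last unfolding pair_word_def mem_Collect_eq case_prod_conv by simp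
    ultimately show ?thesis
      using counts_iff runs_iff unfolding mem_Collect_eq case_prod_conv by blast
  qed
  then have iff: "p \<in> ?P \<longleftrightarrow> pair_word t p \<in> ?W" if "p \<in> {(A, B). A \<union> B = {1..t}}" for p
    using that by (cases p) auto
  have "?P \<subseteq> {(A, B). A \<union> B = {1..t}}"
    by (blast dest: pair_family_Un)
  moreover have "?W \<subseteq> {w. length w = t}"
  proof
    fix w assume "w \<in> ?W"
    then have "length w = (\<Sum>s\<in>UNIV. n s)"
      using sum_count_set[OF subset_UNIV finite_UNIV_letter, of w] by simp
    then show "w \<in> {w. length w = t}"
      using assms(2,3) by (simp add: UNIV_letter n_def)
  qed
  ultimately have "bij_betw (pair_word t) ?P ?W"
    using iff by (intro bij_betw_restrict_iff[OF bij_betw_pair_word])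
  then have "card ?P = card ?W"
    by (rule bij_betw_same_card)
  also have "\<dots> = smirnov_count s' s'' (R Theta) (R Alpha) (R Beta)
      * (\<Prod>s\<in>UNIV. compositions (R s) (n s))"
    by (rule card_words_with_runs)
  also have "(\<Prod>s\<in>UNIV. compositions (R s) (n s)) = (\<Prod>s\<in>UNIV. num_compositions (R s) (n s))"
    using assms(2,3)
    by (intro prod.cong compositions_eq_num_compositions) (auto simp: n_def split: letter.split)
  also have "(\<Prod>s\<in>UNIV. num_compositions (R s) (n s)) = num_compositions (R Theta) (n Theta)
      * num_compositions (R Alpha) (n Alpha) * num_compositions (R Beta) (n Beta)"
    by (simp add: UNIV_letter)
  finally show ?thesis
    unfolding R_def n_def letter.case by (simp only: mult.assoc)
qed

lemma doubleton_Int_iff: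
  assumes "a \<noteq> b"
  shows "{a, b} \<inter> C = {a} \<longleftrightarrow> a \<in> C \<and> b \<notin> C"
    and "{a, b} \<inter> C = {b} \<longleftrightarrow> a \<notin> C \<and> b \<in> C"
    and "{a, b} \<inter> C = {a, b} \<longleftrightarrow> a \<in> C \<and> b \<in> C"
    and "card ({a, b} \<inter> C) = 0 \<longleftrightarrow> a \<notin> C \<and> b \<notin> C"
  using assms by (auto simp: card_eq_0_iff)

theorem theorem4p5:
  fixes t j' j'' lcap l' l'' :: nat
  assumes "t \<ge> 3"
    and "j' > 0" and "j'' > 0" and "max j' j'' < t" and "j' + j'' > t"
    and "lcap \<in> {1..t}" and "l' \<in> {1..t}" and "l'' \<in> {1..t}"
    and "odd lcap" and "odd l'" and "odd l''"
  shows "(card {(A, B) \<in> pair_family t j' j'' lcap l' l''. {1, t} \<inter> A = {1} \<and> {1, t} \<inter> B = {1, t}} =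
        smirnov_count Theta Beta ((lcap + 1) div 2) ((l' - 1) div 2) ((l'' + 1) div 2)
        * num_compositions ((lcap + 1) div 2) (j' + j'' - t)
        * num_compositions ((l' - 1) div 2) (t - j'')
        * num_compositions ((l'' + 1) div 2) (t - j')) \<and>
    (card {(A, B) \<in> pair_family t j' j'' lcap l' l''. {1, t} \<inter> A = {1} \<and> {1, t} \<inter> B = {t}} =
        smirnov_count Alpha Beta ((lcap - 1) div 2) ((l' + 1) div 2) ((l'' + 1) div 2)
        * num_compositions ((lcap - 1) div 2) (j' + j'' - t)
        * num_compositions ((l' + 1) div 2) (t - j'')
        * num_compositions ((l'' + 1) div 2) (t - j')) \<and>
    (card {(A, B) \<in> pair_family t j' j'' lcap l' l''. {1, t} \<inter> A = {1, t} \<and> {1, t} \<inter> B = {1, t}} =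
        smirnov_count Theta Theta ((lcap + 1) div 2) ((l' - 1) div 2) ((l'' - 1) div 2)
        * num_compositions ((lcap + 1) div 2) (j' + j'' - t)
        * num_compositions ((l' - 1) div 2) (t - j'')
        * num_compositions ((l'' - 1) div 2) (t - j')) \<and>
    (card {(A, B) \<in> pair_family t j' j'' lcap l' l''. {1, t} \<inter> A = {1, t} \<and> card ({1, t} \<inter> B) = 0} =
        smirnov_count Alpha Alpha ((lcap - 1) div 2) ((l' + 1) div 2) ((l'' - 1) div 2)
        * num_compositions ((lcap - 1) div 2) (j' + j'' - t)
        * num_compositions ((l' + 1) div 2) (t - j'')
        * num_compositions ((l'' - 1) div 2) (t - j')) \<and>
    (card {(A, B) \<in> pair_family t j' j'' lcap l' l''. {1, t} \<inter> A = {1, t} \<and> {1, t} \<inter> B = {t}} =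
        smirnov_count Alpha Theta ((lcap + 1) div 2) ((l' + 1) div 2) ((l'' - 1) div 2)
        * num_compositions ((lcap + 1) div 2) (j' + j'' - t)
        * num_compositions ((l' + 1) div 2) (t - j'')
        * num_compositions ((l'' - 1) div 2) (t - j'))"
proof -
  have "1 \<le> t" "1 \<noteq> t"
    using \<open>t \<ge> 3\<close> by auto
  note count = card_pairs_with_end_letters[OF this(1) assms(4,5,9,10,11), unfolded runs_of_size_def]
  \<comment> \<open>On the family, \<open>A \<union> B\<close> contains both ends, so an end outside \<open>A\<close> lies in \<open>B\<close>.\<close>
  have ends: "{1, t} \<subseteq> A \<union> B" if "(A, B) \<in> pair_family t j' j'' lcap l' l''" for A B
    using pair_family_Un[OF that] \<open>1 \<le> t\<close> by simp
  have pairs: "{(A, B) \<in> pair_family t j' j'' lcap l' l''. P A B} =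
      {(A, B) \<in> pair_family t j' j'' lcap l' l''. letter_at A B 1 = s' \<and> letter_at A B t = s''}"
    if "\<And>A B. {1, t} \<subseteq> A \<union> B \<Longrightarrow> P A B \<longleftrightarrow> letter_at A B 1 = s' \<and> letter_at A B t = s''" for P s' s''
    by (intro Collect_cong prod.case_cong refl conj_cong that ends)
  have families:
    "{(A, B) \<in> pair_family t j' j'' lcap l' l''. {1, t} \<inter> A = {1} \<and> {1, t} \<inter> B = {1, t}} =
     {(A, B) \<in> pair_family t j' j'' lcap l' l''. letter_at A B 1 = Theta \<and> letter_at A B t = Beta}"
    "{(A, B) \<in> pair_family t j' j'' lcap l' l''. {1, t} \<inter> A = {1} \<and> {1, t} \<inter> B = {t}} =
     {(A, B) \<in> pair_family t j' j'' lcap l' l''. letter_at A B 1 = Alpha \<and> letter_at A B t = Beta}"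
    "{(A, B) \<in> pair_family t j' j'' lcap l' l''. {1, t} \<inter> A = {1, t} \<and> {1, t} \<inter> B = {1, t}} =
     {(A, B) \<in> pair_family t j' j'' lcap l' l''. letter_at A B 1 = Theta \<and> letter_at A B t = Theta}"
    "{(A, B) \<in> pair_family t j' j'' lcap l' l''. {1, t} \<inter> A = {1, t} \<and> card ({1, t} \<inter> B) = 0} =
     {(A, B) \<in> pair_family t j' j'' lcap l' l''. letter_at A B 1 = Alpha \<and> letter_at A B t = Alpha}"
    "{(A, B) \<in> pair_family t j' j'' lcap l' l''. {1, t} \<inter> A = {1, t} \<and> {1, t} \<inter> B = {t}} =
     {(A, B) \<in> pair_family t j' j'' lcap l' l''. letter_at A B 1 = Alpha \<and> letter_at A B t = Theta}"
    by (rule pairs, simp only: doubleton_Int_iff[OF \<open>1 \<noteq> t\<close>] letter_at_eq_iff, blast)+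
  show ?thesis
    unfolding families count by simp
qed

end
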